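(* Let $U\subset\mathbf{R}^2$ be open and connected with coordinates $(\tau,\mu)$, and let $R,\zeta,\kappa:U\to\mathbf{R}$ be smooth functions satisfying $$\partial_\tau^2 R=R\,\partial_\mu(R\,\partial_\mu R),$$ $$\partial_\tau\zeta=\tfrac12\big((\partial_\tau R)^2+R^2(\partial_\mu R)^2\big),\qquad \partial_\mu\zeta=\partial_\tau R\,\partial_\mu R,$$ $$\partial_\mu\kappa=\partial_\tau\zeta,\qquad \partial_\tau\kappa=R^2\,\partial_\mu\zeta .$$ Assume that $(\tau,\mu)\mapsto(\zeta(\tau,\mu),\kappa(\tau,\mu))$ is a diffeomorphism from $U$ onto its open image $V$, and define $\rho:V\to\mathbf{R}$ by $\rho(\zeta(\tau,\mu),\kappa(\tau,\mu))=R(\tau,\mu)$. Let $X,Y:V\to\mathbf{R}$ be smooth functions of $(\zeta,\kappa)$ satisfying $$\partial_\kappa X=\partial_\zeta Y=\tfrac12\big((\partial_\zeta\rho)^2+\rho^2(\partial_\kappa\rho)^2\big),\qquad \partial_\kappa Y=\partial_\zeta\rho\,\partial_\kappa\rho,\qquad \partial_\zeta X=\rho^2\,\partial_\kappa Y=\rho^2\,\partial_\zeta\rho\,\partial_\kappa\rho .$$ Then there are constants $c_1,c_2\in\mathbf{R}$ such that for all $(\tau,\mu)\in U$ $$X(\zeta(\tau,\mu),\kappa(\tau,\mu))=\mu+c_1,\qquad Y(\zeta(\tau,\mu),\kappa(\tau,\mu))=\tau+c_2 .$$ In particular the transformation $R\mapsto\rho$ is involutive up to translations of the independent variables: expressing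 $\rho$ as a function of $(Y,X)$ gives back $R$, i.e. $\rho(\zeta,\kappa)=R\big(Y(\zeta,\kappa)-c_2,\,X(\zeta,\kappa)-c_1\big)$ on $V$.
   Context: All functions are real-valued and smooth. $\partial_\zeta,\partial_\kappa$ denote partial derivatives with respect to the first and second argument of functions on $V$. The transformation in question sends a solution $R(\tau,\mu)$ of $\partial_\tau^2R=R\,\partial_\mu(R\,\partial_\mu R)$ to the function $\rho$ obtained by rewriting $R$ in terms of the associated functions $\zeta,\kappa$. The functions $Y$ and $X$ play for $\rho(\zeta,\kappa)$ the role that $\zeta$ and $\kappa$, respectively, play for $R(\tau,\mu)$. *)

theory Defs
  imports "HOL-Analysis.Analysis"
begin

text \<open>
  Partial derivatives of a real function on the plane with respect to its first and
  second argument, as derivatives of the one-variable slices.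
\<close>

definition pd1 :: "(real \<times> real \<Rightarrow> real) \<Rightarrow> real \<times> real \<Rightarrow> real"
  where "pd1 f p = deriv (\<lambda>s. f (s, snd p)) (fst p)"

definition pd2 :: "(real \<times> real \<Rightarrow> real) \<Rightarrow> real \<times> real \<Rightarrow> real"
  where "pd2 f p = deriv (\<lambda>s. f (fst p, s)) (snd p)"

text \<open>
  \<open>C_k_on k S f\<close> is k-fold continuous differentiability on an open set \<open>S\<close>: the derivative
  is required to be of class \<open>C\<close> of order one less in every fixed direction \<open>v\<close>, which for
  a finite-dimensional domain is the same as for the derivative as a map into the linear maps.
\<close>

primrec C_k_on ::
  "nat \<Rightarrow> 'a::euclidean_space set \<Rightarrow> ('a \<Rightarrow> 'b::real_normed_vector) \<Rightarrow> bool"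
where
  "C_k_on 0 S f \<longleftrightarrow> continuous_on S f"
| "C_k_on (Suc k) S f \<longleftrightarrow>
     (\<forall>x\<in>S. f differentiable at x) \<and> (\<forall>v. C_k_on k S (\<lambda>x. frechet_derivative f (at x) v))"

definition smooth_on ::
  "'a::euclidean_space set \<Rightarrow> ('a \<Rightarrow> 'b::real_normed_vector) \<Rightarrow> bool"
  where "smooth_on S f \<longleftrightarrow> (\<forall>k. C_k_on k S f)"

definition diffeomorphism_between ::
  "'a::euclidean_space set \<Rightarrow> 'b::euclidean_space set \<Rightarrow> ('a \<Rightarrow> 'b) \<Rightarrow> bool"
  where "diffeomorphism_between U V f \<longleftrightarrow>
     open U \<and> open V \<and> smooth_on U f \<and> (\<exists>g. smooth_on V g \<and> homeomorphism U V f g)"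

end

theory Submission
  imports Defs
begin

text \<open>
  Write \<open>A = (R\<^sub>\<tau>\<^sup>2 + R\<^sup>2 R\<^sub>\<mu>\<^sup>2)/2\<close> and \<open>B = R\<^sub>\<tau> R\<^sub>\<mu>\<close>. The map \<open>F = (\<zeta>, \<kappa>)\<close> has Jacobian matrix with
  rows \<open>(A, B)\<close> and \<open>(R\<^sup>2 B, A)\<close>, whose determinant \<open>J = A\<^sup>2 - R\<^sup>2 B\<^sup>2\<close> is the square of
  \<open>D/2\<close> with \<open>D = R\<^sub>\<tau>\<^sup>2 - R\<^sup>2 R\<^sub>\<mu>\<^sup>2\<close>, and is nonzero because \<open>F\<close> has a differentiable inverse.
  Solving the chain rule for \<open>\<rho> \<circ> F = R\<close> gives \<open>\<rho>\<^sub>\<zeta> = 2 R\<^sub>\<tau> / D\<close> and \<open>\<rho>\<^sub>\<kappa> = - 2 R\<^sub>\<mu> / D\<close>. Hence the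
  expressions that prescribe the derivatives of \<open>Y\<close> and \<open>X\<close> are
  \<open>A/J\<close>, \<open>- B/J\<close> and \<open>- R\<^sup>2 B/J\<close>, \<open>A/J\<close>: these are the rows of the inverse Jacobian matrix
  (\<open>dual_coefficients\<close>). By the chain rule \<open>Y \<circ> F\<close> and \<open>X \<circ> F\<close> therefore have the same derivatives as
  the coordinates \<open>\<tau>\<close> and \<open>\<mu>\<close>, and on the connected set \<open>U\<close> they differ from them by constants.
\<close>

lemma smooth_on_imp_differentiable:
  assumes "smooth_on S f" "x \<in> S"
  shows "f differentiable at x"
proof -
  have "C_k_on (Suc 0) S f"
    using assms(1) unfolding smooth_on_def by blast
  then show ?thesis
    using assms(2) by simp
qed

lemma has_derivative_pd:
  fixes f :: "real \<times> real \<Rightarrow> real"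
  assumes "f differentiable at p"
  shows "(f has_derivative (\<lambda>h. pd1 f p * fst h + pd2 f p * snd h)) (at p)"
proof -
  obtain L where L: "(f has_derivative L) (at p)"
    using assms unfolding differentiable_def by blast
  interpret L: bounded_linear L
    using L by (rule has_derivative_bounded_linear)
  have "((\<lambda>s. f (s, snd p)) has_derivative (\<lambda>h. L (h, 0))) (at (fst p))"
    by (rule has_derivative_compose[of "\<lambda>s. (s, snd p)" _ _ _ f L, simplified])
       (use L in \<open>auto intro!: derivative_eq_intros\<close>)
  moreover have "(\<lambda>h. L (h, 0)) = (*) (L (1, 0))"
  proof
    fix h show "L (h, 0) = L (1, 0) * h"
      using L.scaleR[of h "(1, 0)"] by (simp add: mult.commute)
  qed
  ultimately have 1: "pd1 f p = L (1, 0)"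
    unfolding pd1_def by (intro DERIV_imp_deriv) (simp add: has_field_derivative_def)
  have "((\<lambda>s. f (fst p, s)) has_derivative (\<lambda>h. L (0, h))) (at (snd p))"
    by (rule has_derivative_compose[of "\<lambda>s. (fst p, s)" _ _ _ f L, simplified])
       (use L in \<open>auto intro!: derivative_eq_intros\<close>)
  moreover have "(\<lambda>h. L (0, h)) = (*) (L (0, 1))"
  proof
    fix h show "L (0, h) = L (0, 1) * h"
      using L.scaleR[of h "(0, 1)"] by (simp add: mult.commute)
  qed
  ultimately have 2: "pd2 f p = L (0, 1)"
    unfolding pd2_def by (intro DERIV_imp_deriv) (simp add: has_field_derivative_def)
  have "L h = pd1 f p * fst h + pd2 f p * snd h" for h
  proof -
    have "L h = L (fst h *\<^sub>R (1, 0) + snd h *\<^sub>R (0, 1))"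
      by simp
    also have "\<dots> = pd1 f p * fst h + pd2 f p * snd h"
      unfolding L.add L.scaleR 1 2 by (simp add: mult.commute)
    finally show ?thesis .
  qed
  then have "L = (\<lambda>h. pd1 f p * fst h + pd2 f p * snd h)" ..
  then show ?thesis
    using L by simp
qed

lemma has_derivative_pd_compose:
  fixes f u v :: "real \<times> real \<Rightarrow> real"
  assumes "u differentiable at p" "v differentiable at p" "f differentiable at (u p, v p)"
  shows "((\<lambda>x. f (u x, v x)) has_derivative
    (\<lambda>h. (pd1 f (u p, v p) * pd1 u p + pd2 f (u p, v p) * pd1 v p) * fst h
       + (pd1 f (u p, v p) * pd2 u p + pd2 f (u p, v p) * pd2 v p) * snd h)) (at p)"
proof -
  have "((\<lambda>x. (u x, v x)) has_derivative
      (\<lambda>h. (pd1 u p * fst h + pd2 u p * snd h, pd1 v p * fst h + pd2 v p * snd h))) (at p)"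
    using assms(1,2) by (intro has_derivative_Pair has_derivative_pd)
  from has_derivative_compose[OF this has_derivative_pd[OF assms(3)]]
  show ?thesis
    by (simp add: algebra_simps)
qed

lemma has_derivative_coeffs_unique:
  fixes a b c d :: real
  assumes "(f has_derivative (\<lambda>h. a * fst h + b * snd h)) (at (p :: real \<times> real))"
    and "(f has_derivative (\<lambda>h. c * fst h + d * snd h)) (at p)"
  shows "a = c" "b = d"
proof -
  have "(\<lambda>h. a * fst h + b * snd h) = (\<lambda>h. c * fst h + d * snd h)"
    using assms by (rule has_derivative_unique)
  from fun_cong[OF this, of "(1, 0)"] fun_cong[OF this, of "(0, 1)"]
  show "a = c" "b = d" by simp_all
qed

text \<open>
  If the determinant vanished, the adjugate matrix would map into the kernel of the Jacobian,
  which is trivial because of the left inverse; then the Jacobian itself would be zero.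
\<close>

lemma jacobian_nonzero:
  fixes u v :: "real \<times> real \<Rightarrow> real" and g :: "real \<times> real \<Rightarrow> real \<times> real"
  assumes "open U" "p \<in> U" "u differentiable at p" "v differentiable at p"
    and "g differentiable at (u p, v p)"
    and inv: "\<And>x. x \<in> U \<Longrightarrow> g (u x, v x) = x"
  shows "pd1 u p * pd2 v p - pd2 u p * pd1 v p \<noteq> 0"
proof
  assume J: "pd1 u p * pd2 v p - pd2 u p * pd1 v p = 0"
  define M where
    "M = (\<lambda>h. (pd1 u p * fst h + pd2 u p * snd h, pd1 v p * fst h + pd2 v p * snd h))"
  obtain G where G: "(g has_derivative G) (at (u p, v p))"
    using assms(5) unfolding differentiable_def by blast
  have "((\<lambda>x. (u x, v x)) has_derivative M) (at p)"
    unfolding M_def using assms(3,4) by (intro has_derivative_Pair has_derivative_pd)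
  from has_derivative_compose[OF this G]
  have "((\<lambda>x. x) has_derivative (\<lambda>h. G (M h))) (at p)"
    by (rule has_derivative_transform_within_open[OF _ assms(1,2)]) (rule inv)
  then have "(\<lambda>h. G (M h)) = (\<lambda>h. h)"
    using has_derivative_ident by (rule has_derivative_unique)
  then have GM: "G (M h) = h" for h
    by metis
  have "G (0, 0) = 0"
    using has_derivative_bounded_linear[OF G] linear_simps(3) by (simp flip: zero_prod_def)
  then have ker: "h = 0" if "M h = (0, 0)" for h
    using GM[of h] that by simp
  have "M (- pd2 u p, pd1 u p) = (0, 0)" "M (pd2 v p, - pd1 v p) = (0, 0)"
    using J by (simp_all add: M_def algebra_simps)
  from this[THEN ker] have "M (1, 0) = (0, 0)"
    by (simp add: M_def zero_prod_def)
  then show False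
    using ker[of "(1, 0)"] by (simp add: zero_prod_def)
qed

text \<open>
  The pointwise algebra of the involution: \<open>a, b\<close> are the derivatives of \<open>R\<close>, \<open>c, d\<close> those of \<open>\<rho>\<close>,
  and the first two hypotheses are the chain rule for \<open>\<rho> \<circ> F = R\<close>. The conclusion says
  that \<open>(A', B')\<close>, the analogue of \<open>(A, B)\<close> for \<open>\<rho>\<close>, is the first row of the inverse Jacobian
  matrix; the second row \<open>(r\<^sup>2 B', A')\<close> has the same symmetric form. The determinant is the square
  of \<open>D/2\<close> with \<open>D = a\<^sup>2 - r\<^sup>2 b\<^sup>2\<close>, so \<open>D\<close> may be used as a denominator.
\<close>

lemma dual_coefficients:
  fixes a b c d r :: real
  defines "A \<equiv> 1/2 * (a\<^sup>2 + r\<^sup>2 * b\<^sup>2)" and "B \<equiv> a * b"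
  defines "A' \<equiv> 1/2 * (c\<^sup>2 + r\<^sup>2 * d\<^sup>2)" and "B' \<equiv> c * d"
  assumes a: "c * A + d * (r\<^sup>2 * B) = a" and b: "c * B + d * A = b"
    and J: "A * A - B * (r\<^sup>2 * B) \<noteq> 0"
  shows "A' * A + B' * (r\<^sup>2 * B) = 1" and "A' * B + B' * A = 0"
proof -
  define D where "D = a\<^sup>2 - r\<^sup>2 * b\<^sup>2"
  have JD: "A * A - B * (r\<^sup>2 * B) = (D / 2)\<^sup>2"
    unfolding A_def B_def D_def by (simp add: field_simps power2_eq_square)
  then have D: "D \<noteq> 0"
    using J by auto
  have div_J: "e = 2 * x / D" if "e * (A * A - B * (r\<^sup>2 * B)) = x * D / 2" for e x
    using that D unfolding JD by (simp add: field_simps power2_eq_square)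
  have "c * (A * A - B * (r\<^sup>2 * B)) = a * A - b * (r\<^sup>2 * B)"
    unfolding a[symmetric] b[symmetric] by (simp add: algebra_simps)
  also have "\<dots> = a * D / 2"
    unfolding A_def B_def D_def by (simp add: field_simps power2_eq_square)
  finally have c: "c = 2 * a / D"
    by (rule div_J)
  have "- d * (A * A - B * (r\<^sup>2 * B)) = a * B - b * A"
    unfolding a[symmetric] b[symmetric] by (simp add: algebra_simps)
  also have "\<dots> = b * D / 2"
    unfolding A_def B_def D_def by (simp add: field_simps power2_eq_square)
  finally have "- d = 2 * b / D"
    by (rule div_J)
  then have d: "d = - (2 * b / D)"
    by simp
  have A': "A' = 4 * A / D\<^sup>2"
    unfolding A'_def A_def c d by (simp add: power_divide power_mult_distrib add_divide_distrib)
  have B': "B' = - (4 * B / D\<^sup>2)"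
    unfolding B'_def B_def c d by (simp add: power2_eq_square)
  have "A' * A + B' * (r\<^sup>2 * B) = (A * A - B * (r\<^sup>2 * B)) / (D / 2)\<^sup>2"
    unfolding A' B' by (simp add: diff_divide_distrib power_divide algebra_simps)
  then show "A' * A + B' * (r\<^sup>2 * B) = 1"
    using D by (simp only: JD) simp
  show "A' * B + B' * A = 0"
    unfolding A' B' by simp
qed

lemma differ_by_constant:
  fixes f g :: "'a::euclidean_space \<Rightarrow> real"
  assumes "open S" "connected S"
    and "\<And>x. x \<in> S \<Longrightarrow> (f has_derivative D x) (at x)"
    and "\<And>x. x \<in> S \<Longrightarrow> (g has_derivative D x) (at x)"
  shows "\<exists>c. \<forall>x\<in>S. f x = g x + c"
proof -
  have der: "((\<lambda>x. f x - g x) has_derivative (\<lambda>h. 0)) (at x)" if "x \<in> S" for x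
    using has_derivative_diff[OF assms(3,4)[OF that]] by simp
  have "f x - g x = f y - g y" if "x \<in> S" "y \<in> S" for x y
    using has_derivative_zero_unique_connected[OF assms(1,2) der that] .
  then have "\<exists>c. \<forall>x\<in>S. f x - g x = c"
    by metis
  then show ?thesis
    by (auto simp: algebra_simps)
qed

theorem mainTheorem3:
  fixes U V :: "(real \<times> real) set"
    and R \<zeta> \<kappa> \<rho> X Y :: "real \<times> real \<Rightarrow> real"
  assumes "open U" and "connected U"
    and "smooth_on U R" and "smooth_on U \<zeta>" and "smooth_on U \<kappa>"
    and "\<forall>p\<in>U. pd1 (pd1 R) p = R p * pd2 (\<lambda>q. R q * pd2 R q) p"
    and "\<forall>p\<in>U. pd1 \<zeta> p = 1/2 * ((pd1 R p)\<^sup>2 + (R p)\<^sup>2 * (pd2 R p)\<^sup>2)"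
    and "\<forall>p\<in>U. pd2 \<zeta> p = pd1 R p * pd2 R p"
    and "\<forall>p\<in>U. pd2 \<kappa> p = pd1 \<zeta> p"
    and "\<forall>p\<in>U. pd1 \<kappa> p = (R p)\<^sup>2 * pd2 \<zeta> p"
    and "V = (\<lambda>p. (\<zeta> p, \<kappa> p)) ` U"
    and "diffeomorphism_between U V (\<lambda>p. (\<zeta> p, \<kappa> p))"
    and "\<forall>p\<in>U. \<rho> (\<zeta> p, \<kappa> p) = R p"
    and "smooth_on V X" and "smooth_on V Y"
    and "\<forall>q\<in>V. pd2 X q = pd1 Y q"
    and "\<forall>q\<in>V. pd1 Y q = 1/2 * ((pd1 \<rho> q)\<^sup>2 + (\<rho> q)\<^sup>2 * (pd2 \<rho> q)\<^sup>2)"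
    and "\<forall>q\<in>V. pd2 Y q = pd1 \<rho> q * pd2 \<rho> q"
    and "\<forall>q\<in>V. pd1 X q = (\<rho> q)\<^sup>2 * pd2 Y q"
  shows "\<exists>c1 c2 :: real.
      (\<forall>\<tau> \<mu>. (\<tau>, \<mu>) \<in> U \<longrightarrow>
         X (\<zeta> (\<tau>, \<mu>), \<kappa> (\<tau>, \<mu>)) = \<mu> + c1 \<and>
         Y (\<zeta> (\<tau>, \<mu>), \<kappa> (\<tau>, \<mu>)) = \<tau> + c2) \<and>
      (\<forall>q\<in>V. (Y q - c2, X q - c1) \<in> U \<and> \<rho> q = R (Y q - c2, X q - c1))"
proof -
  let ?F = "\<lambda>p. (\<zeta> p, \<kappa> p)"
  obtain g where opV: "open V" and g: "smooth_on V g" and hom: "homeomorphism U V ?F g"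
    using assms(12) unfolding diffeomorphism_between_def by blast
  have gF: "g (?F p) = p" if "p \<in> U" for p
    using homeomorphism_apply1[OF hom that] .
  have Fg: "?F (g q) = q" and gU: "g q \<in> U" if "q \<in> V" for q
    using homeomorphism_apply2[OF hom that] homeomorphism_image2[OF hom] that by auto
  have dR: "R differentiable at p" and d\<zeta>: "\<zeta> differentiable at p"
    and d\<kappa>: "\<kappa> differentiable at p" and FV: "?F p \<in> V" if "p \<in> U" for p
    using that assms(3-5,11) by (auto intro: smooth_on_imp_differentiable)
  have dg: "g differentiable at q" and dX: "X differentiable at q"
    and dY: "Y differentiable at q" if "q \<in> V" for q
    using that g assms(14,15) by (auto intro: smooth_on_imp_differentiable)
  \<comment> \<open>Differentiability of \<open>\<rho>\<close> comes from \<open>\<rho> = R \<circ> g\<close>.\<close>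
  have d\<rho>: "\<rho> differentiable at q" if q: "q \<in> V" for q
  proof -
    obtain G where "(g has_derivative G) (at q)"
      using dg[OF q] unfolding differentiable_def by blast
    from has_derivative_compose[OF this has_derivative_pd[OF dR[OF gU[OF q]]]]
    have "(\<rho> has_derivative
        (\<lambda>h. pd1 R (g q) * fst (G h) + pd2 R (g q) * snd (G h))) (at q)"
    proof (rule has_derivative_transform_within_open[OF _ opV q])
      fix x assume "x \<in> V"
      then show "R (g x) = \<rho> x"
        using assms(13) gU Fg by metis
    qed
    then show ?thesis
      unfolding differentiable_def by blast
  qed
  have derivs: "((\<lambda>p. X (?F p)) has_derivative snd) (at p)"
    "((\<lambda>p. Y (?F p)) has_derivative fst) (at p)" if p: "p \<in> U" for p
  proof -
    let ?q = "?F p"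
    note q = FV[OF p]
    define A where "A = 1/2 * ((pd1 R p)\<^sup>2 + (R p)\<^sup>2 * (pd2 R p)\<^sup>2)"
    define B where "B = pd1 R p * pd2 R p"
    have F: "pd1 \<zeta> p = A" "pd2 \<zeta> p = B" "pd1 \<kappa> p = (R p)\<^sup>2 * B" "pd2 \<kappa> p = A"
      using assms(7-10) p by (auto simp: A_def B_def)
    have \<rho>q: "\<rho> ?q = R p"
      using assms(13) p by blast
    define A' where "A' = 1/2 * ((pd1 \<rho> ?q)\<^sup>2 + (R p)\<^sup>2 * (pd2 \<rho> ?q)\<^sup>2)"
    define B' where "B' = pd1 \<rho> ?q * pd2 \<rho> ?q"
    have XY: "pd1 Y ?q = A'" "pd2 Y ?q = B'" "pd1 X ?q = (R p)\<^sup>2 * B'" "pd2 X ?q = A'"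
      using assms(16-19) q \<rho>q by (auto simp: A'_def B'_def)
    have J: "A * A - B * ((R p)\<^sup>2 * B) \<noteq> 0"
      using jacobian_nonzero[OF assms(1) p d\<zeta>[OF p] d\<kappa>[OF p] dg[OF q] gF] by (simp add: F)
    have "(R has_derivative
        (\<lambda>h. (pd1 \<rho> ?q * A + pd2 \<rho> ?q * ((R p)\<^sup>2 * B)) * fst h
           + (pd1 \<rho> ?q * B + pd2 \<rho> ?q * A) * snd h)) (at p)"
      by (rule has_derivative_transform_within_open[OF _ assms(1) p,
            OF has_derivative_pd_compose[OF d\<zeta>[OF p] d\<kappa>[OF p] d\<rho>[OF q], unfolded F]])
         (use assms(13) in blast)
    from has_derivative_coeffs_unique[OF this has_derivative_pd[OF dR[OF p]]]
    have "pd1 \<rho> ?q * A + pd2 \<rho> ?q * ((R p)\<^sup>2 * B) = pd1 R p"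
      "pd1 \<rho> ?q * B + pd2 \<rho> ?q * A = pd2 R p" .
    note dual = dual_coefficients[OF this[unfolded A_def B_def] J[unfolded A_def B_def],
        folded A_def B_def A'_def B'_def]
    have "(R p)\<^sup>2 * B' * A + A' * ((R p)\<^sup>2 * B) = (R p)\<^sup>2 * (A' * B + B' * A)"
      by (simp add: algebra_simps)
    then have 0: "(R p)\<^sup>2 * B' * A + A' * ((R p)\<^sup>2 * B) = 0"
      using dual(2) by simp
    have 1: "(R p)\<^sup>2 * B' * B + A' * A = 1"
      using dual(1) by (simp add: algebra_simps)
    show "((\<lambda>p. X (?F p)) has_derivative snd) (at p)"
      using has_derivative_pd_compose[OF d\<zeta>[OF p] d\<kappa>[OF p] dX[OF q], unfolded F XY 0 1]
      by simp
    show "((\<lambda>p. Y (?F p)) has_derivative fst) (at p)"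
      using has_derivative_pd_compose[OF d\<zeta>[OF p] d\<kappa>[OF p] dY[OF q], unfolded F XY dual]
      by simp
  qed
  obtain c1 where c1: "\<forall>p\<in>U. X (?F p) = snd p + c1"
    using differ_by_constant[OF assms(1,2) derivs(1), of snd]
    by (auto intro: bounded_linear_imp_has_derivative bounded_linear_snd)
  obtain c2 where c2: "\<forall>p\<in>U. Y (?F p) = fst p + c2"
    using differ_by_constant[OF assms(1,2) derivs(2), of fst]
    by (auto intro: bounded_linear_imp_has_derivative bounded_linear_fst)
  have "(Y q - c2, X q - c1) \<in> U \<and> \<rho> q = R (Y q - c2, X q - c1)" if "q \<in> V" for q
  proof -
    from that obtain p where p: "p \<in> U" "q = ?F p"
      using assms(11) by blast
    then have "(Y q - c2, X q - c1) = p"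
      using c1 c2 by simp
    then show ?thesis
      using p assms(13) by simp
  qed
  then show ?thesis
    using c1 c2 by (intro exI[of _ c1] exI[of _ c2]) auto
qed

end
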